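(* Every hereditary Baire topology $\tau$ on the semigroup $\mathscr{I}^{\infty}_\omega$ such that $(\mathscr{I}^{\infty}_\omega,\tau)$ is a Hausdorff semitopological semigroup is discrete.
   Context: $\omega$ is the first infinite cardinal (regarded as a set). $\mathscr{I}_\omega$ is the symmetric inverse semigroup of all partial one-to-one maps from $\omega$ to $\omega$; maps are written on the right and composed left to right: $(x)(\alpha\beta)=((x)\alpha)\beta$ for $x\in\operatorname{dom}(\alpha\beta)=\{y\in\operatorname{dom}\alpha\mid (y)\alpha\in\operatorname{dom}\beta\}$. A map $\alpha\in\mathscr{I}_\omega$ is almost everywhere the identity if $\omega\setminus\operatorname{dom}\alpha$ is finite and $(x)\alpha\neq x$ only for finitely many $x\in\operatorname{dom}\alpha$. $\mathscr{I}^{\infty}_\omega\subseteq\mathscr{I}_\omega$ is the inverse subsemigroup of all such maps. A semitopological semigroup is a topological space with a separately continuous semigroup operation. A topological space $X$ is Baire if for each sequence $A_1,A_2,\ldots$ of nowhere dense subsets of $X$ the union $\bigcup_{i=1}^\infty A_i$ is co-dense in $X$ (its complement is dense). A space is hereditary Baire if each of its closed subsets is a Baire space; a topology is hereditary Baire if the corresponding space is. *)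

theory Defs
  imports "HOL-Analysis.Analysis"
begin

text \<open>
  The set \<open>\<omega>\<close> is rendered as the type \<^typ>\<open>nat\<close>, and a partial map from \<open>\<omega>\<close> to \<open>\<omega>\<close>
  as a function of type \<^typ>\<open>nat \<Rightarrow> nat option\<close>, undefined points being sent to \<^const>\<open>None\<close>.
\<close>

definition symmetric_inverse_semigroup :: "(nat \<Rightarrow> nat option) set" where
  "symmetric_inverse_semigroup = {\<alpha>. inj_on \<alpha> (dom \<alpha>)}"

text \<open>
  Maps act on the right, so the product \<open>\<alpha> \<beta>\<close> applies \<open>\<alpha>\<close> first; \<^const>\<open>map_comp\<close> applies
  its second argument first.
\<close>

definition pmult :: "(nat \<Rightarrow> nat option) \<Rightarrow> (nat \<Rightarrow> nat option) \<Rightarrow> (nat \<Rightarrow> nat option)" where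
  "pmult \<alpha> \<beta> = \<beta> \<circ>\<^sub>m \<alpha>"

definition almost_everywhere_identity :: "(nat \<Rightarrow> nat option) \<Rightarrow> bool" where
  "almost_everywhere_identity \<alpha> \<longleftrightarrow>
     finite (UNIV - dom \<alpha>) \<and> finite {x \<in> dom \<alpha>. \<alpha> x \<noteq> Some x}"

definition I_omega_inf :: "(nat \<Rightarrow> nat option) set" where
  "I_omega_inf = {\<alpha> \<in> symmetric_inverse_semigroup. almost_everywhere_identity \<alpha>}"

definition semitopological_semigroup :: "'a topology \<Rightarrow> ('a \<Rightarrow> 'a \<Rightarrow> 'a) \<Rightarrow> bool" where
  "semitopological_semigroup X m \<longleftrightarrow>
     (\<forall>a\<in>topspace X. \<forall>b\<in>topspace X. m a b \<in> topspace X) \<and>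
     (\<forall>a\<in>topspace X. \<forall>b\<in>topspace X. \<forall>c\<in>topspace X. m (m a b) c = m a (m b c)) \<and>
     (\<forall>a\<in>topspace X. continuous_map X X (\<lambda>x. m a x)) \<and>
     (\<forall>a\<in>topspace X. continuous_map X X (\<lambda>x. m x a))"

definition nowhere_dense_in :: "'a topology \<Rightarrow> 'a set \<Rightarrow> bool" where
  "nowhere_dense_in X A \<longleftrightarrow> A \<subseteq> topspace X \<and> X interior_of (X closure_of A) = {}"

definition dense_in :: "'a topology \<Rightarrow> 'a set \<Rightarrow> bool" where
  "dense_in X A \<longleftrightarrow> A \<subseteq> topspace X \<and> X closure_of A = topspace X"

definition Baire_space :: "'a topology \<Rightarrow> bool" where
  "Baire_space X \<longleftrightarrow>
     (\<forall>A :: nat \<Rightarrow> 'a set. (\<forall>i. nowhere_dense_in X (A i)) \<longrightarrow>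
        dense_in X (topspace X - (\<Union>i. A i)))"

definition hereditary_Baire_space :: "'a topology \<Rightarrow> bool" where
  "hereditary_Baire_space X \<longleftrightarrow> (\<forall>F. closedin X F \<longrightarrow> Baire_space (subtopology X F))"

end

theory Submission
  imports Defs
begin

text \<open>
  A Hausdorff hereditary Baire topology on a countable set is scattered. If the closed set of
  non-isolated points of \<open>\<tau>\<close> were nonempty, it would have a relatively isolated point \<open>\<alpha>\<close>. All
  two-sided translations \<open>x \<mapsto> g x h\<close> are continuous and have finite fibres, so isolatedness
  passes from a value to its arguments; hence every element of defect
  \<open>|\<omega> - dom \<beta>| \<ge> |\<omega> - dom \<alpha>|\<close> is non-isolated. For the idempotent \<open>e\<close> with domain \<open>dom \<alpha>\<close> the
  map \<open>x \<mapsto> e x\<close> takes only such values and fixes \<open>\<alpha>\<close>, so near \<open>\<alpha>\<close> it is constantly \<open>\<alpha>\<close>.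
  Finiteness of the fibre makes \<open>\<alpha>\<close> isolated, a contradiction.
\<close>

section \<open>The semigroup\<close>

lemma pmult_apply: "pmult a b n = (case a n of None \<Rightarrow> None | Some k \<Rightarrow> b k)"
  by (simp add: pmult_def map_comp_def)

lemma pmult_assoc: "pmult (pmult a b) c = pmult a (pmult b c)"
  by (rule ext) (simp add: pmult_apply split: option.split)

text \<open>Since \<open>None\<close> differs from \<open>Some n\<close>, the single set of
  \<open>n\<close> with \<open>a n \<noteq> Some n\<close> collects both the undefined and the moved
  points.\<close>

lemma I_omega_inf_iff:
  "a \<in> I_omega_inf \<longleftrightarrow>
     (\<forall>m n k. a m = Some k \<longrightarrow> a n = Some k \<longrightarrow> m = n) \<and> finite {n. a n \<noteq> Some n}"
proof -
  have "{n. a n \<noteq> Some n} = (UNIV - dom a) \<union> {x \<in> dom a. a x \<noteq> Some x}" by auto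
  moreover have "inj_on a (dom a) \<longleftrightarrow> (\<forall>m n k. a m = Some k \<longrightarrow> a n = Some k \<longrightarrow> m = n)"
    by (fastforce simp: inj_on_def dom_def)
  ultimately show ?thesis
    by (simp add: I_omega_inf_def symmetric_inverse_semigroup_def almost_everywhere_identity_def)
qed

lemma I_omega_inf_inj:
  "a \<in> I_omega_inf \<Longrightarrow> a m = Some k \<Longrightarrow> a n = Some k \<Longrightarrow> m = n"
  by (auto simp: I_omega_inf_iff)

lemma I_omega_inf_finite: "a \<in> I_omega_inf \<Longrightarrow> finite {n. a n \<noteq> Some n}"
  by (auto simp: I_omega_inf_iff)

lemma finite_co_dom: "a \<in> I_omega_inf \<Longrightarrow> finite (- dom a)"
  by (rule finite_subset[OF _ I_omega_inf_finite]) auto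

lemma pmult_closed:
  assumes "a \<in> I_omega_inf" "b \<in> I_omega_inf"
  shows "pmult a b \<in> I_omega_inf"
proof -
  have "{n. pmult a b n \<noteq> Some n} \<subseteq> {n. a n \<noteq> Some n} \<union> {n. b n \<noteq> Some n}"
    by (auto simp: pmult_apply)
  then have "finite {n. pmult a b n \<noteq> Some n}"
    using assms[THEN I_omega_inf_finite] by (meson finite_UnI finite_subset)
  moreover have "m = n" if "pmult a b m = Some k" "pmult a b n = Some k" for m n k
    using that assms[THEN I_omega_inf_inj]
    by (auto simp: pmult_apply split: option.splits)
  ultimately show ?thesis by (auto simp: I_omega_inf_iff)
qed

definition id_on :: "nat set \<Rightarrow> nat \<Rightarrow> nat option" where
  "id_on A n = (if n \<in> A then Some n else None)"

lemma dom_id_on [simp]: "dom (id_on A) = A"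
  by (auto simp: id_on_def dom_def)

lemma id_on_closed: "finite (- A) \<Longrightarrow> id_on A \<in> I_omega_inf"
  by (auto simp: I_omega_inf_iff id_on_def Compl_eq split: if_splits)

lemma pmult_id_on_dom: "pmult (id_on (dom a)) a = a"
  by (rule ext) (auto simp: pmult_apply id_on_def domIff)

lemma pmult_id_on_UNIV: "pmult a (id_on UNIV) = a"
  by (rule ext) (auto simp: pmult_apply id_on_def split: option.split)

text \<open>The inverse in the inverse semigroup; injectivity of \<open>a\<close> leaves
  \<open>SOME\<close> no real choice.\<close>

definition pinv :: "(nat \<Rightarrow> nat option) \<Rightarrow> nat \<Rightarrow> nat option" where
  "pinv a k = (if \<exists>n. a n = Some k then Some (SOME n. a n = Some k) else None)"

lemma pinv_eq_Some_iff:
  assumes "a \<in> I_omega_inf"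
  shows "pinv a k = Some n \<longleftrightarrow> a n = Some k"
  unfolding pinv_def using I_omega_inf_inj[OF assms] by (auto intro: someI)

lemma pinv_closed:
  assumes "a \<in> I_omega_inf"
  shows "pinv a \<in> I_omega_inf"
  using I_omega_inf_finite[OF assms]
  by (auto simp: I_omega_inf_iff pinv_eq_Some_iff[OF assms])

lemma pmult_pinv:
  assumes "a \<in> I_omega_inf"
  shows "pmult a (pinv a) = id_on (dom a)"
proof
  fix n show "pmult a (pinv a) n = id_on (dom a) n"
    by (cases "a n") (auto simp: pmult_apply id_on_def pinv_eq_Some_iff[OF assms])
qed

text \<open>A finite code for an element: off the recorded points the map is the identity. Values
  stay in the option type so that undefined points are recorded too. It serves both countability and
  the finiteness of fibres.\<close>

definition moved_graph :: "(nat \<Rightarrow> nat option) \<Rightarrow> (nat \<times> nat option) set" where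
  "moved_graph a = (\<lambda>n. (n, a n)) ` {n. a n \<noteq> Some n}"

lemma inj_moved_graph: "inj moved_graph"
proof (rule injI)
  fix a b assume "moved_graph a = moved_graph b"
  then have *: "(n, y) \<in> moved_graph a \<longleftrightarrow> (n, y) \<in> moved_graph b" for n y by simp
  show "a = b"
  proof
    fix n show "a n = b n"
      using *[of n "a n"] *[of n "b n"] by (auto simp: moved_graph_def)
  qed
qed

lemma countable_I_omega_inf: "countable I_omega_inf"
proof -
  have "moved_graph ` I_omega_inf \<subseteq> {A. finite A}"
    by (auto simp: moved_graph_def I_omega_inf_finite)
  then have "countable (moved_graph ` I_omega_inf)"
    by (rule countable_subset) (rule countable_Collect_finite)
  then show ?thesis
    using inj_moved_graph by (meson countable_image_inj_on inj_on_subset subset_UNIV)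
qed

text \<open>Outside a finite set \<open>F\<close> all of \<open>g\<close>, \<open>h\<close>,
  \<open>b\<close> are the identity, so the equation and injectivity of \<open>h\<close> make
  \<open>x\<close> the identity there. Thus \<open>x\<close> is determined by a partial map from
  \<open>F\<close> to \<open>F\<close>.\<close>

lemma finite_translation_fibre:
  assumes g: "g \<in> I_omega_inf" and h: "h \<in> I_omega_inf" and b: "b \<in> I_omega_inf"
  shows "finite {x \<in> I_omega_inf. pmult (pmult g x) h = b}" (is "finite ?X")
proof -
  define F where "F = {n. g n \<noteq> Some n} \<union> {n. h n \<noteq> Some n} \<union> {n. b n \<noteq> Some n}"
  have "finite F" unfolding F_def using g h b by (simp add: I_omega_inf_finite)
  have "moved_graph x \<in> Pow (F \<times> insert None (Some ` F))" if "x \<in> ?X" for x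
  proof -
    have x: "x \<in> I_omega_inf" and eq: "pmult (pmult g x) h = b" using that by auto
    have fix_off: "x n = Some n" if n: "n \<notin> F" for n
    proof -
      have "pmult (pmult g x) h n = Some n" using n eq by (auto simp: F_def)
      then obtain k where k: "x n = Some k" "h k = Some n"
        using n by (auto simp: F_def pmult_apply split: option.splits)
      moreover have "h n = Some n" using n by (auto simp: F_def)
      ultimately show ?thesis using I_omega_inf_inj[OF h] by metis
    qed
    \<comment> \<open>A value \<open>k\<close> outside \<open>F\<close> is already taken at the
      fixed point \<open>k\<close>, so injectivity of \<open>x\<close> excludes it at any other
      point.\<close>
    then have "k \<in> F" if "x n = Some k" "n \<noteq> k" for n k
      using that I_omega_inf_inj[OF x] by metis
    then show ?thesis using fix_off by (fastforce simp: moved_graph_def)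
  qed
  then have "moved_graph ` ?X \<subseteq> Pow (F \<times> insert None (Some ` F))" by blast
  then have "finite (moved_graph ` ?X)"
    by (rule finite_subset) (simp add: \<open>finite F\<close>)
  then show ?thesis
    using inj_moved_graph by (meson finite_image_iff inj_on_subset subset_UNIV)
qed

lemma exists_embedding_of_domain:
  assumes A: "finite (- A)" and B: "finite (- B)" and le: "card (- A) \<le> card (- B)"
  shows "\<exists>g \<in> I_omega_inf. dom g = B \<and> ran g \<subseteq> A"
proof -
  have "card (B - A) \<le> card (A - B)"
  proof -
    \<comment> \<open>Cancelling the common part \<open>- (A \<union> B)\<close> turns the
      comparison of defects into one of the differences.\<close>
    have "- A = (B - A) \<union> - (A \<union> B)" "- B = (A - B) \<union> - (A \<union> B)" by auto
    moreover have "finite (B - A)" "finite (A - B)" "finite (- (A \<union> B))"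
      using A B by (auto intro: finite_subset[OF _ A] finite_subset[OF _ B])
    moreover have "(B - A) \<inter> - (A \<union> B) = {}" "(A - B) \<inter> - (A \<union> B) = {}" by auto
    ultimately have "card (- A) = card (B - A) + card (- (A \<union> B))"
        "card (- B) = card (A - B) + card (- (A \<union> B))"
      by (metis card_Un_disjoint)+
    then show ?thesis using le by simp
  qed
  moreover have fin: "finite (B - A)" "finite (A - B)"
    by (auto intro: finite_subset[OF _ A] finite_subset[OF _ B])
  ultimately obtain f where f: "f ` (B - A) \<subseteq> A - B" "inj_on f (B - A)"
    using card_le_inj by blast
  \<comment> \<open>Fixing the common points keeps \<open>g\<close> almost everywhere the identity;
    only the finite set \<open>B - A\<close> has to be moved, into the free places
    \<open>A - B\<close>.\<close>
  define g where "g n = (if n \<in> A \<inter> B then Some n else if n \<in> B then Some (f n) else None)" for n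
  have "{n. g n \<noteq> Some n} \<subseteq> - A \<union> - B" by (auto simp: g_def)
  then have "finite {n. g n \<noteq> Some n}" using A B by (meson finite_UnI finite_subset)
  moreover have "m = n" if "g m = Some k" "g n = Some k" for m n k
    using that f by (auto simp: g_def inj_on_def split: if_splits)
  ultimately have "g \<in> I_omega_inf" by (auto simp: I_omega_inf_iff)
  moreover have "dom g = B" by (auto simp: g_def dom_def)
  moreover have "ran g \<subseteq> A" using f by (auto simp: g_def ran_def split: if_splits)
  ultimately show ?thesis by blast
qed

text \<open>Take \<open>g\<close> with domain \<open>dom b\<close> and range inside
  \<open>dom a\<close>. Then \<open>ga\<close> has domain \<open>dom b\<close>, so its product with
  its inverse is a left identity for \<open>b\<close>, and \<open>h\<close> can be the inverse of
  \<open>ga\<close> times \<open>b\<close>.\<close>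

lemma exists_translation:
  assumes a: "a \<in> I_omega_inf" and b: "b \<in> I_omega_inf"
    and le: "card (- dom a) \<le> card (- dom b)"
  shows "\<exists>g \<in> I_omega_inf. \<exists>h \<in> I_omega_inf. pmult (pmult g a) h = b"
proof -
  obtain g where g: "g \<in> I_omega_inf" "dom g = dom b" "ran g \<subseteq> dom a"
    using exists_embedding_of_domain[OF finite_co_dom[OF a] finite_co_dom[OF b] le] by blast
  have ga: "pmult g a \<in> I_omega_inf" using g a by (simp add: pmult_closed)
  have "pmult g a n = None \<longleftrightarrow> g n = None" for n
    using g(3) ranI[of g n] by (cases "g n") (auto simp: pmult_apply domIff)
  then have "dom (pmult g a) = dom b" using g(2) by (auto simp: dom_def)
  then have "pmult (pmult g a) (pmult (pinv (pmult g a)) b) = b"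
    by (metis ga pmult_assoc pmult_id_on_dom pmult_pinv)
  then show ?thesis using g(1) b ga pinv_closed pmult_closed by blast
qed

section \<open>Isolated points\<close>

text \<open>Otherwise every singleton, being closed, is nowhere dense, and countably many of them
  exhaust the space.\<close>

lemma Baire_countable_has_isolated_point:
  assumes "Baire_space X" "t1_space X" "countable (topspace X)" "topspace X \<noteq> {}"
  shows "\<exists>x \<in> topspace X. openin X {x}"
proof (rule ccontr)
  assume no: "\<not> ?thesis"
  \<comment> \<open>\<open>from_nat_into\<close> repeats a point when the space is finite, so a
    sequence indexed by all naturals exists in either case.\<close>
  define A where "A i = {from_nat_into (topspace X) i}" for i
  have "nowhere_dense_in X (A i)" for i
  proof -
    define x where "x = from_nat_into (topspace X) i"
    have x: "x \<in> topspace X" using assms(4) by (simp add: x_def from_nat_into)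
    then have "X closure_of {x} = {x}"
      using assms(2) by (simp add: closure_of_eq t1_space_closedin_singleton)
    moreover have "X interior_of {x} = {}"
      using no x by (metis interior_of_subset openin_interior_of subset_singletonD)
    ultimately show ?thesis using x by (simp add: nowhere_dense_in_def A_def x_def)
  qed
  moreover have "(\<Union>i. A i) = topspace X"
    using range_from_nat_into[OF assms(4,3)] by (auto simp: A_def)
  ultimately have "dense_in X {}"
    using assms(1) unfolding Baire_space_def by (metis Diff_cancel)
  then show False using assms(4) by (simp add: dense_in_def)
qed

lemma openin_singleton_of_finite_open:
  assumes "t1_space X" "openin X U" "finite U" "x \<in> U"
  shows "openin X {x}"
proof -
  have "U - {x} \<subseteq> topspace X" using openin_subset[OF assms(2)] by blast
  then have "closedin X (U - {x})" using assms(1,3) by (simp add: t1_space_closedin_finite)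
  then have "openin X (U - (U - {x}))" using assms(2) by (rule openin_diff[rotated])
  moreover have "U - (U - {x}) = {x}" using assms(4) by blast
  ultimately show ?thesis by simp
qed

theorem theorem5p1:
  fixes \<tau> :: "(nat \<Rightarrow> nat option) topology"
  assumes "topspace \<tau> = I_omega_inf"
    and "hereditary_Baire_space \<tau>"
    and "Hausdorff_space \<tau>"
    and "semitopological_semigroup \<tau> pmult"
  shows "\<tau> = discrete_topology I_omega_inf"
proof -
  have t1: "t1_space \<tau>" using assms(3) by (rule Hausdorff_imp_t1_space)
  have cont: "continuous_map \<tau> \<tau> (\<lambda>x. pmult (pmult g x) h)"
    if "g \<in> I_omega_inf" "h \<in> I_omega_inf" for g h
    using assms(4) that continuous_map_compose[of \<tau> \<tau> "\<lambda>x. pmult g x" \<tau> "\<lambda>x. pmult x h"]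
    by (auto simp: semitopological_semigroup_def assms(1) o_def)
  \<comment> \<open>The preimage of \<open>U\<close> is open and lies in the finite fibre over
    \<open>b\<close>. Allowing \<open>U\<close> to be larger than \<open>{b}\<close> covers the
    later case where \<open>b\<close> is isolated only among the values of the translation.\<close>
  have pullback: "openin \<tau> {x}"
    if gh: "g \<in> I_omega_inf" "h \<in> I_omega_inf" and x: "x \<in> I_omega_inf" and U: "openin \<tau> U"
      and only: "\<And>y. y \<in> I_omega_inf \<Longrightarrow> pmult (pmult g y) h \<in> U \<Longrightarrow> pmult (pmult g y) h = b"
      and xb: "pmult (pmult g x) h = b" and b: "b \<in> U" for g h x b U
  proof -
    define V where "V = {y \<in> topspace \<tau>. pmult (pmult g y) h \<in> U}"
    have "openin \<tau> V"
      unfolding V_def using cont[OF gh] U by (rule openin_continuous_map_preimage)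
    moreover have "finite V"
    proof (rule finite_subset)
      show "V \<subseteq> {y \<in> I_omega_inf. pmult (pmult g y) h = b}"
        using only by (auto simp: V_def assms(1))
      have "b \<in> I_omega_inf" using b openin_subset[OF U] assms(1) by auto
      then show "finite {y \<in> I_omega_inf. pmult (pmult g y) h = b}"
        using gh by (simp add: finite_translation_fibre)
    qed
    moreover have "x \<in> V" using x xb b by (simp add: V_def assms(1))
    ultimately show ?thesis using t1 by (blast intro: openin_singleton_of_finite_open)
  qed
  define N where "N = {x \<in> topspace \<tau>. \<not> openin \<tau> {x}}"
  \<comment> \<open>A translation carrying \<open>a\<close> to an isolated \<open>b\<close> would
    isolate \<open>a\<close>.\<close>
  have N_up: "b \<in> N"
    if ab: "a \<in> N" "b \<in> I_omega_inf" "card (- dom a) \<le> card (- dom b)" for a b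
  proof (rule ccontr)
    assume "b \<notin> N"
    then have "openin \<tau> {b}" using ab by (simp add: N_def assms(1))
    moreover obtain g h where "g \<in> I_omega_inf" "h \<in> I_omega_inf" "pmult (pmult g a) h = b"
      using exists_translation[of a b] ab by (auto simp: N_def assms(1))
    ultimately have "openin \<tau> {a}"
      using ab(1) by (intro pullback[of g h a "{b}" b]) (auto simp: N_def assms(1))
    then show False using ab(1) by (simp add: N_def)
  qed
  have "N = {}"
  proof (rule ccontr)
    assume "N \<noteq> {}"
    \<comment> \<open>The isolated points form an open set, so \<open>N\<close> is closed and
      inherits the Baire property.\<close>
    have "topspace \<tau> - N = \<Union> {{x} |x. openin \<tau> {x}}"
      by (auto simp: N_def dest: openin_subset)
    then have "openin \<tau> (topspace \<tau> - N)" by (auto intro: openin_Union)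
    then have "closedin \<tau> N" by (auto simp: closedin_def N_def)
    moreover have top: "topspace (subtopology \<tau> N) = N"
      by (auto simp: N_def)
    moreover have "countable N"
      using countable_I_omega_inf by (rule countable_subset[rotated]) (auto simp: N_def assms(1))
    ultimately obtain a where a: "a \<in> N" "openin (subtopology \<tau> N) {a}"
      using Baire_countable_has_isolated_point[of "subtopology \<tau> N"] assms(2) \<open>N \<noteq> {}\<close>
      by (auto simp: hereditary_Baire_space_def t1_space_subtopology t1)
    then obtain U where U: "openin \<tau> U" "U \<inter> N = {a}"
      by (metis openin_subtopology Int_commute)
    have aS: "a \<in> I_omega_inf" using a(1) by (simp add: N_def assms(1))
    \<comment> \<open>Left multiplication by \<open>e\<close> fixes \<open>a\<close> and restricts
      every \<open>y\<close> to points of \<open>dom a\<close>, so no value has smaller defect than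
      \<open>a\<close>.\<close>
    define e where "e = id_on (dom a)"
    have e: "e \<in> I_omega_inf" by (simp add: e_def id_on_closed finite_co_dom[OF aS])
    have "pmult e y \<in> N" if y: "y \<in> I_omega_inf" for y
    proof (rule N_up[OF a(1)])
      show "pmult e y \<in> I_omega_inf" using e y by (rule pmult_closed)
      moreover have "- dom a \<subseteq> - dom (pmult e y)"
        by (auto simp: e_def id_on_def pmult_apply split: if_splits)
      ultimately show "card (- dom a) \<le> card (- dom (pmult e y))"
        by (simp add: card_mono finite_co_dom)
    qed
    \<comment> \<open>All values of the translation lie in \<open>N\<close>, so those in
      \<open>U\<close> lie in \<open>U \<inter> N = {a}\<close>. The right factor is the identity of
      the semigroup.\<close>
    then have "openin \<tau> {a}"
      using U by (intro pullback[OF e id_on_closed[of UNIV] aS, of U a])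
        (auto simp: pmult_id_on_UNIV e_def pmult_id_on_dom)
    then show False using a(1) by (simp add: N_def)
  qed
  then have "openin \<tau> {x}" if "x \<in> I_omega_inf" for x
    using that by (auto simp: N_def assms(1))
  then show ?thesis
    by (metis assms(1) discrete_topology_unique)
qed

end
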